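(* For any graph $G$, $\chi'^t_d(G^{\frac{1}{3}})\leq \chi'^t_d(G^{\frac{1}{4}})$.
   Context: Graphs are simple. Two edges are adjacent if they are distinct and share an endpoint. A total dominator edge coloring (TDE-coloring) of a graph $G$ is a proper edge coloring of $G$ in which each edge of $G$ is adjacent to every edge of some color class (a color class is the set of all edges assigned a given used color). The total dominator edge chromatic number $\chi'^t_d(G)$ is the minimum number of color classes in a TDE-coloring of $G$. For a positive integer $k$, the $k$-subdivision $G^{\frac{1}{k}}$ of $G$ is the graph obtained by replacing each edge of $G$ with a path of length $k$ (i.e. with $k$ edges and $k-1$ new internal vertices) between its endpoints. *)

theory Defs
  imports Main "HOL-Library.Extended_Nat"
begin

text \<open>A graph is a pair of a vertex set and a set of two-element sets of vertices; neither set
  is required to be finite.\<close>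

type_synonym 'a ugraph = "'a set \<times> 'a set set"

abbreviation verts :: "'a ugraph \<Rightarrow> 'a set" where "verts G \<equiv> fst G"
abbreviation edges :: "'a ugraph \<Rightarrow> 'a set set" where "edges G \<equiv> snd G"

definition simple_graph :: "'a ugraph \<Rightarrow> bool" where
  "simple_graph G \<longleftrightarrow> (\<forall>e\<in>edges G. e \<subseteq> verts G \<and> card e = 2)"

definition adjacent_edges :: "'a set \<Rightarrow> 'a set \<Rightarrow> bool" where
  "adjacent_edges e f \<longleftrightarrow> e \<noteq> f \<and> e \<inter> f \<noteq> {}"

definition proper_edge_coloring :: "'a ugraph \<Rightarrow> ('a set \<Rightarrow> 'c) \<Rightarrow> bool" where
  "proper_edge_coloring G c \<longleftrightarrow>
     (\<forall>e\<in>edges G. \<forall>f\<in>edges G. adjacent_edges e f \<longrightarrow> c e \<noteq> c f)"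

definition color_classes :: "'a ugraph \<Rightarrow> ('a set \<Rightarrow> 'c) \<Rightarrow> 'a set set set" where
  "color_classes G c = {{e \<in> edges G. c e = a} | a. a \<in> c ` edges G}"

definition TDE_coloring :: "'a ugraph \<Rightarrow> ('a set \<Rightarrow> 'c) \<Rightarrow> bool" where
  "TDE_coloring G c \<longleftrightarrow> proper_edge_coloring G c \<and>
     (\<forall>e\<in>edges G. \<exists>C\<in>color_classes G c. \<forall>f\<in>C. adjacent_edges e f)"

text \<open>The infimum over \<^typ>\<open>enat\<close> is attained (hence a minimum) whenever there is a TDE-coloring
  with finitely many color classes, and is \<open>\<infinity>\<close> otherwise.  Natural numbers suffice as colors,
  since only colorings with finitely many classes contribute.\<close>

definition TDE_chromatic_number :: "'a ugraph \<Rightarrow> enat" where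
  "TDE_chromatic_number G =
     (INF c \<in> {c :: 'a set \<Rightarrow> nat. TDE_coloring G c \<and> finite (color_classes G c)}.
        enat (card (color_classes G c)))"

text \<open>\<open>subdiv_point k u v i\<close> is the vertex at distance \<open>i\<close> from \<open>u\<close> on the path of length \<open>k\<close>
  that replaces the edge \<open>{u, v}\<close>.  An internal vertex is encoded by its distances to both ends of
  the path, so that the encoding does not depend on an orientation of the edge.\<close>

datatype 'a subdiv_vertex = Original 'a | Internal "('a \<times> nat) set"

definition subdiv_point :: "nat \<Rightarrow> 'a \<Rightarrow> 'a \<Rightarrow> nat \<Rightarrow> 'a subdiv_vertex" where
  "subdiv_point k u v i =
     (if i = 0 then Original u else if i = k then Original v
      else Internal {(u, i), (v, k - i)})"

lemma subdiv_point_commute: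
  "0 < k \<Longrightarrow> i \<le> k \<Longrightarrow> subdiv_point k u v i = subdiv_point k v u (k - i)"
  by (auto simp: subdiv_point_def)

lemma inj_on_subdiv_point: "u \<noteq> v \<Longrightarrow> inj_on (subdiv_point k u v) {..k}"
  by (rule inj_onI) (simp add: subdiv_point_def doubleton_eq_iff split: if_splits)

text \<open>Meaningful for \<open>k > 0\<close> only.\<close>

definition subdivision :: "nat \<Rightarrow> 'a ugraph \<Rightarrow> 'a subdiv_vertex ugraph" where
  "subdivision k G =
     (Original ` verts G \<union> {subdiv_point k u v i | u v i. {u, v} \<in> edges G \<and> 0 < i \<and> i < k},
      {{subdiv_point k u v i, subdiv_point k u v (Suc i)} | u v i. {u, v} \<in> edges G \<and> i < k})"

lemma simple_graph_subdivision:
  assumes "simple_graph G" "0 < k"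
  shows "simple_graph (subdivision k G)"
proof -
  have *: "{subdiv_point k u v i, subdiv_point k u v (Suc i)} \<subseteq> verts (subdivision k G) \<and>
        card {subdiv_point k u v i, subdiv_point k u v (Suc i)} = 2"
    if e: "{u, v} \<in> edges G" and i: "i < k" for u v i
  proof -
    have uv: "u \<noteq> v" "u \<in> verts G" "v \<in> verts G"
    proof -
      have "{u, v} \<subseteq> verts G" "card {u, v} = 2"
        using assms(1) e unfolding simple_graph_def by blast+
      then show "u \<noteq> v" "u \<in> verts G" "v \<in> verts G" by (cases "u = v"; simp)+
    qed
    have pt: "subdiv_point k u v j \<in> verts (subdivision k G)" if "j \<le> k" for j
    proof (cases "j = 0 \<or> j = k")
      case True
      then show ?thesis using uv by (auto simp: subdivision_def subdiv_point_def)
    next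
      case False
      then have "0 < j" "j < k" using that by auto
      then show ?thesis using e unfolding subdivision_def fst_conv by blast
    qed
    have "subdiv_point k u v i \<noteq> subdiv_point k u v (Suc i)"
      using inj_onD[OF inj_on_subdiv_point[OF uv(1)], of k i "Suc i"] i by auto
    then show ?thesis using pt[of i] pt[of "Suc i"] i by auto
  qed
  show ?thesis
    unfolding simple_graph_def
  proof
    fix e assume "e \<in> edges (subdivision k G)"
    then obtain u v i where "{u, v} \<in> edges G" "i < k"
      and e: "e = {subdiv_point k u v i, subdiv_point k u v (Suc i)}"
      unfolding subdivision_def by auto
    then show "e \<subseteq> verts (subdivision k G) \<and> card e = 2"
      unfolding e by (intro *)
  qed
qed

end

theory Submission
  imports Defs
begin

text \<open>
  Let \<open>m\<close> be the number of edges of \<open>G\<close>.  Both sides are compared with \<open>2 * m\<close>.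

  \<^item> In the 3-subdivision, give the two outer segments of each subdivided edge a common color and
    its middle segment a color of its own.  A middle segment is adjacent to all of the first class,
    and each outer segment is adjacent to the only member of the second, so these \<open>2 * m\<close> classes
    form a TDE-coloring (\<open>TDE_chromatic_number_subdivision_3_le\<close>).

  \<^item> In the 4-subdivision, an inner segment has only two adjacent edges: the outer segment on its own
    side and the inner segment on the opposite side.  The class that it dominates is a nonempty
    subset of this pair.  The pairs that belong to the \<open>2 * m\<close> inner segments are pairwise disjoint,
    so every TDE-coloring has at least \<open>2 * m\<close> classes (\<open>card_color_classes_subdivision_4_ge\<close>).
    The same argument shows that \<open>G\<close> has finitely many edges as soon as its 4-subdivision has a
    TDE-coloring with finitely many classes; if it has none, the right-hand side is infinite.

  Inner segments of the 4-subdivision correspond to the darts of \<open>G\<close>, that is, its edges with an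
  orientation.
\<close>

section \<open>Colors and color classes\<close>

lemma color_classes_altdef:
  "color_classes G c = (\<lambda>a. {e \<in> edges G. c e = a}) ` c ` edges G"
  by (auto simp: color_classes_def)

lemma TDE_coloringI:
  assumes "\<And>e f. e \<in> edges G \<Longrightarrow> f \<in> edges G \<Longrightarrow> c f = c e \<Longrightarrow> \<not> adjacent_edges e f"
    and "\<And>e. e \<in> edges G \<Longrightarrow> \<exists>x\<in>edges G. \<forall>f\<in>edges G. c f = c x \<longrightarrow> adjacent_edges e f"
  shows "TDE_coloring G c"
  unfolding TDE_coloring_def
proof
  show "proper_edge_coloring G c"
    unfolding proper_edge_coloring_def using assms(1) by metis
  show "\<forall>e\<in>edges G. \<exists>C\<in>color_classes G c. \<forall>f\<in>C. adjacent_edges e f"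
    using assms(2) unfolding color_classes_altdef by (simp, meson)
qed

lemma color_classes_comp_inj:
  assumes "inj_on h (c ` edges G)"
  shows "color_classes G (h \<circ> c) = color_classes G c"
  unfolding color_classes_altdef image_image o_def
  by (intro image_cong refl Collect_cong) (simp add: inj_on_eq_iff[OF assms] cong: conj_cong)

lemma TDE_coloring_comp_inj:
  assumes "inj_on h (c ` edges G)" and "TDE_coloring G c"
  shows "TDE_coloring G (h \<circ> c)"
  using assms unfolding TDE_coloring_def color_classes_comp_inj[OF assms(1)]
  by (simp add: proper_edge_coloring_def inj_on_eq_iff[OF assms(1)])

text \<open>The chromatic number is defined through colorings by natural numbers; finitely many colors
  of any type can be renamed to natural numbers, so that a convenient type may be used.\<close>

lemma TDE_chromatic_number_le:
  assumes tde: "TDE_coloring G c" and fin: "finite (c ` edges G)"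
  shows "TDE_chromatic_number G \<le> enat (card (c ` edges G))"
proof -
  obtain h :: "_ \<Rightarrow> nat" where h: "inj_on h (c ` edges G)"
    using finite_imp_inj_to_nat_seg[OF fin] by blast
  have "finite (color_classes G c)"
    using fin by (simp add: color_classes_altdef)
  then have "TDE_chromatic_number G \<le> enat (card (color_classes G c))"
    using TDE_coloring_comp_inj[OF h tde] color_classes_comp_inj[OF h]
    unfolding TDE_chromatic_number_def by (intro INF_lower2[of "h \<circ> c"]) auto
  also have "\<dots> \<le> enat (card (c ` edges G))"
    unfolding color_classes_altdef by (simp add: card_image_le fin)
  finally show ?thesis .
qed

section \<open>Darts\<close>

definition darts :: "'a ugraph \<Rightarrow> ('a \<times> 'a) set" where
  "darts G = {(u, v). {u, v} \<in> edges G}"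

lemma simple_graph_edgeE:
  assumes "simple_graph G" and "e \<in> edges G"
  obtains u v where "e = {u, v}" and "u \<noteq> v"
proof -
  have "card e = 2"
    using assms by (simp add: simple_graph_def)
  then show ?thesis
    using that by (auto simp: card_2_iff)
qed

lemma edges_eq_darts:
  assumes "simple_graph G"
  shows "edges G = (\<lambda>(u, v). {u, v}) ` darts G"
proof (intro subset_antisym subsetI)
  fix e assume e: "e \<in> edges G"
  obtain u v where "e = {u, v}" "u \<noteq> v"
    by (rule simple_graph_edgeE[OF assms e])
  then show "e \<in> (\<lambda>(u, v). {u, v}) ` darts G"
    using e by (intro image_eqI[of _ _ "(u, v)"]) (auto simp: darts_def)
qed (auto simp: darts_def)

lemma card_darts:
  assumes "simple_graph G" and "finite (edges G)"
  shows "card (darts G) = 2 * card (edges G)"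
proof -
  let ?D = "\<lambda>e. {(u, v). {u, v} = e}"
  have D: "finite (?D e) \<and> card (?D e) = 2" if e: "e \<in> edges G" for e
  proof -
    obtain u v where uv: "e = {u, v}" "u \<noteq> v"
      by (rule simple_graph_edgeE[OF assms(1) e])
    then have "?D e = {(u, v), (v, u)}"
      by (auto simp: doubleton_eq_iff)
    then show ?thesis
      using uv by simp
  qed
  have "darts G = (\<Union>e\<in>edges G. ?D e)"
    by (auto simp: darts_def)
  also have "card \<dots> = (\<Sum>e\<in>edges G. card (?D e))"
    using assms(2) D by (intro card_UN_disjoint) auto
  also have "\<dots> = 2 * card (edges G)"
    using D by simp
  finally show ?thesis .
qed

section \<open>The 3-subdivision\<close>

definition outer3 :: "'a \<Rightarrow> 'a \<Rightarrow> 'a subdiv_vertex set" where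
  "outer3 u v = {Original u, Internal {(u, 1), (v, 2)}}"

definition middle3 :: "'a \<Rightarrow> 'a \<Rightarrow> 'a subdiv_vertex set" where
  "middle3 u v = {Internal {(u, 1), (v, 2)}, Internal {(v, 1), (u, 2)}}"

lemma edges_subdivision_3:
  "f \<in> edges (subdivision 3 G) \<longleftrightarrow>
     (\<exists>u v. {u, v} \<in> edges G \<and> (f = outer3 u v \<or> f = middle3 u v))"
proof -
  have seg: "{subdiv_point 3 u v 0, subdiv_point 3 u v (Suc 0)} = outer3 u v"
    "{subdiv_point 3 u v 1, subdiv_point 3 u v (Suc 1)} = middle3 u v"
    "{subdiv_point 3 u v 2, subdiv_point 3 u v (Suc 2)} = outer3 v u" for u v :: 'a
    unfolding subdiv_point_def outer3_def middle3_def
    by (simp; auto simp: insert_commute numeral_2_eq_2)+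
  have less3: "i < 3 \<longleftrightarrow> i = 0 \<or> i = 1 \<or> i = 2" for i :: nat
    by auto
  have path: "(\<exists>i<3. f = {subdiv_point 3 u v i, subdiv_point 3 u v (Suc i)}) \<longleftrightarrow>
      f = outer3 u v \<or> f = middle3 u v \<or> f = outer3 v u" for u v
    unfolding less3 by (simp only: conj_disj_distribR ex_disj_distrib simp_thms seg)
  have "f \<in> edges (subdivision 3 G) \<longleftrightarrow> (\<exists>u v. {u, v} \<in> edges G \<and>
      (\<exists>i<3. f = {subdiv_point 3 u v i, subdiv_point 3 u v (Suc i)}))"
    by (auto simp: subdivision_def)
  then have ends: "f \<in> edges (subdivision 3 G) \<longleftrightarrow> (\<exists>u v. {u, v} \<in> edges G \<and>
      (f = outer3 u v \<or> f = middle3 u v \<or> f = outer3 v u))"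
    unfolding path .
  have "{v, u} \<in> edges G" if "{u, v} \<in> edges G" for u v
    using that by (simp add: insert_commute)
  then show ?thesis
    unfolding ends by blast
qed

text \<open>The edge of \<open>G\<close> whose subdivision contains a given segment can be read off the internal
  vertices of the segment, since these record both ends of the path.\<close>

definition parent_edge :: "'a subdiv_vertex set \<Rightarrow> 'a set" where
  "parent_edge f = (\<Union>S\<in>{S. Internal S \<in> f}. fst ` S)"

text \<open>The Boolean component tells the outer segments from the middle one: only the former touch a
  vertex of \<open>G\<close>.\<close>

definition coloring3 :: "'a subdiv_vertex set \<Rightarrow> 'a set \<times> bool" where
  "coloring3 f = (parent_edge f, f \<inter> range Original \<noteq> {})"

lemma outer3_eq_iff: "outer3 u v = outer3 x y \<longleftrightarrow> u = x \<and> v = y"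
  by (auto simp: outer3_def doubleton_eq_iff)

lemma middle3_eq_iff: "middle3 u v = middle3 x y \<longleftrightarrow> {u, v} = {x, y}"
  by (auto simp: middle3_def doubleton_eq_iff)

lemma outer3_neq_middle3: "outer3 u v \<noteq> middle3 x y"
  by (simp add: outer3_def middle3_def doubleton_eq_iff)

lemma coloring3_outer3: "coloring3 (outer3 u v) = ({u, v}, True)"
proof -
  have "{S. Internal S \<in> outer3 u v} = {{(u, 1), (v, 2)}}"
    by (simp add: outer3_def)
  then show ?thesis
    by (simp add: coloring3_def parent_edge_def) (simp add: outer3_def)
qed

lemma coloring3_middle3: "coloring3 (middle3 u v) = ({u, v}, False)"
proof -
  have "{S. Internal S \<in> middle3 u v} = {{(u, 1), (v, 2)}, {(v, 1), (u, 2)}}"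
    by (auto simp: middle3_def)
  moreover have "middle3 u v \<inter> range Original = {}"
    by (auto simp: middle3_def)
  ultimately show ?thesis
    by (simp add: coloring3_def parent_edge_def insert_commute)
qed

lemmas coloring3_simps = coloring3_outer3 coloring3_middle3

lemma coloring3_eq_True:
  assumes "f \<in> edges (subdivision 3 G)"
  shows "coloring3 f = ({u, v}, True) \<longleftrightarrow> f = outer3 u v \<or> f = outer3 v u"
proof -
  obtain x y where "f = outer3 x y \<or> f = middle3 x y"
    using assms unfolding edges_subdivision_3 by blast
  then show ?thesis
    by (elim disjE) (simp_all add: coloring3_simps outer3_eq_iff doubleton_eq_iff
        outer3_neq_middle3[symmetric])
qed

lemma coloring3_eq_False:
  assumes "f \<in> edges (subdivision 3 G)"
  shows "coloring3 f = ({u, v}, False) \<longleftrightarrow> f = middle3 u v"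
proof -
  obtain x y where "f = outer3 x y \<or> f = middle3 x y"
    using assms unfolding edges_subdivision_3 by blast
  then show ?thesis
    by (elim disjE) (simp_all add: coloring3_simps middle3_eq_iff outer3_neq_middle3)
qed

text \<open>The two outer segments of a path of length 3 may share a color because the middle segment
  keeps them apart, provided that the subdivided edge is not a loop.\<close>

lemma outer3_disjoint: "u \<noteq> v \<Longrightarrow> outer3 u v \<inter> outer3 v u = {}"
  by (simp add: outer3_def doubleton_eq_iff)

lemma adjacent_outer3_middle3:
  "adjacent_edges (outer3 u v) (middle3 u v)" "adjacent_edges (middle3 u v) (outer3 u v)"
  "adjacent_edges (middle3 u v) (outer3 v u)"
  using outer3_neq_middle3[of u v u v] outer3_neq_middle3[of v u u v]
  by (simp_all add: adjacent_edges_def) (simp_all add: outer3_def middle3_def)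

text \<open>Domination takes place within each subdivided edge: the outer segments dominate the class of
  the middle one, and conversely.\<close>

lemma TDE_coloring_coloring3:
  assumes "simple_graph G"
  shows "TDE_coloring (subdivision 3 G) coloring3"
proof (rule TDE_coloringI)
  let ?H = "subdivision 3 G"
  fix f g
  assume f: "f \<in> edges ?H" and g: "g \<in> edges ?H" and eq: "coloring3 g = coloring3 f"
  obtain u v where uv: "{u, v} \<in> edges G" "f = outer3 u v \<or> f = middle3 u v"
    using f unfolding edges_subdivision_3 by blast
  from uv(2) show "\<not> adjacent_edges f g"
  proof
    assume outer: "f = outer3 u v"
    then have "g = outer3 u v \<or> g = outer3 v u"
      using eq coloring3_eq_True[OF g] by (simp add: coloring3_simps)
    moreover have "u \<noteq> v"
      using uv(1) assms by (auto simp: simple_graph_def)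
    ultimately show ?thesis
      using outer outer3_disjoint unfolding adjacent_edges_def by metis
  next
    assume middle: "f = middle3 u v"
    then have "g = f"
      using eq coloring3_eq_False[OF g] by (simp add: coloring3_simps)
    then show ?thesis
      by (simp add: adjacent_edges_def)
  qed
next
  let ?H = "subdivision 3 G"
  fix f
  assume "f \<in> edges ?H"
  then obtain u v where uv: "{u, v} \<in> edges G" "f = outer3 u v \<or> f = middle3 u v"
    unfolding edges_subdivision_3 by blast
  have outer: "outer3 u v \<in> edges ?H" and middle: "middle3 u v \<in> edges ?H"
    using uv(1) unfolding edges_subdivision_3 by blast+
  from uv(2) show "\<exists>x\<in>edges ?H. \<forall>g\<in>edges ?H. coloring3 g = coloring3 x \<longrightarrow> adjacent_edges f g"
  proof
    assume "f = outer3 u v"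
    moreover have "g = middle3 u v" if "g \<in> edges ?H" "coloring3 g = coloring3 (middle3 u v)" for g
      using that coloring3_eq_False[of g G u v] by (simp add: coloring3_simps)
    ultimately show ?thesis
      using middle adjacent_outer3_middle3(1) by metis
  next
    assume "f = middle3 u v"
    moreover have "g = outer3 u v \<or> g = outer3 v u"
      if "g \<in> edges ?H" "coloring3 g = coloring3 (outer3 u v)" for g
      using that coloring3_eq_True[of g G u v] by (simp add: coloring3_simps)
    ultimately show ?thesis
      using outer adjacent_outer3_middle3(2,3) by metis
  qed
qed

lemma TDE_chromatic_number_subdivision_3_le:
  assumes "simple_graph G" and fin: "finite (edges G)"
  shows "TDE_chromatic_number (subdivision 3 G) \<le> enat (2 * card (edges G))"
proof -
  let ?H = "subdivision 3 G"
  have sub: "coloring3 ` edges ?H \<subseteq> edges G \<times> UNIV"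
    by (auto simp: edges_subdivision_3 coloring3_simps)
  then have "finite (coloring3 ` edges ?H)"
    by (rule finite_subset) (simp add: fin)
  then have "TDE_chromatic_number ?H \<le> enat (card (coloring3 ` edges ?H))"
    using TDE_chromatic_number_le[OF TDE_coloring_coloring3[OF assms(1)]] by blast
  also have "\<dots> \<le> enat (card (edges G \<times> (UNIV :: bool set)))"
    using fin sub by (simp only: enat_ord_simps) (intro card_mono, simp_all)
  finally show ?thesis
    by (simp add: card_cartesian_product mult.commute)
qed

section \<open>The 4-subdivision\<close>

text \<open>The dart \<open>(u, v)\<close> gives the first two segments of the path from \<open>u\<close> to \<open>v\<close>; the last
  two belong to the dart \<open>(v, u)\<close>.\<close>

definition outer4 :: "'a \<Rightarrow> 'a \<Rightarrow> 'a subdiv_vertex set" where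
  "outer4 u v = {Original u, Internal {(u, 1), (v, 3)}}"

definition inner4 :: "'a \<Rightarrow> 'a \<Rightarrow> 'a subdiv_vertex set" where
  "inner4 u v = {Internal {(u, 1), (v, 3)}, Internal {(u, 2), (v, 2)}}"

lemma edges_subdivision_4:
  "f \<in> edges (subdivision 4 G) \<longleftrightarrow>
     (\<exists>u v. {u, v} \<in> edges G \<and> (f = outer4 u v \<or> f = inner4 u v))"
proof -
  have seg: "{subdiv_point 4 u v 0, subdiv_point 4 u v (Suc 0)} = outer4 u v"
    "{subdiv_point 4 u v 1, subdiv_point 4 u v (Suc 1)} = inner4 u v"
    "{subdiv_point 4 u v 2, subdiv_point 4 u v (Suc 2)} = inner4 v u"
    "{subdiv_point 4 u v 3, subdiv_point 4 u v (Suc 3)} = outer4 v u" for u v :: 'a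
    unfolding subdiv_point_def outer4_def inner4_def
    by (simp; auto simp: insert_commute numeral_2_eq_2)+
  have less4: "i < 4 \<longleftrightarrow> i = 0 \<or> i = 1 \<or> i = 2 \<or> i = 3" for i :: nat
    by auto
  have path: "(\<exists>i<4. f = {subdiv_point 4 u v i, subdiv_point 4 u v (Suc i)}) \<longleftrightarrow>
      f = outer4 u v \<or> f = inner4 u v \<or> f = inner4 v u \<or> f = outer4 v u" for u v
    unfolding less4 by (simp only: conj_disj_distribR ex_disj_distrib simp_thms seg)
  have "f \<in> edges (subdivision 4 G) \<longleftrightarrow> (\<exists>u v. {u, v} \<in> edges G \<and>
      (\<exists>i<4. f = {subdiv_point 4 u v i, subdiv_point 4 u v (Suc i)}))"
    by (auto simp: subdivision_def)
  then have ends: "f \<in> edges (subdivision 4 G) \<longleftrightarrow> (\<exists>u v. {u, v} \<in> edges G \<and>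
      (f = outer4 u v \<or> f = inner4 u v \<or> f = inner4 v u \<or> f = outer4 v u))"
    unfolding path .
  have "{v, u} \<in> edges G" if "{u, v} \<in> edges G" for u v
    using that by (simp add: insert_commute)
  then show ?thesis
    unfolding ends by blast
qed

lemma outer4_eq_iff: "outer4 u v = outer4 x y \<longleftrightarrow> u = x \<and> v = y"
  by (auto simp: outer4_def doubleton_eq_iff)

lemma inner4_eq_iff: "inner4 u v = inner4 x y \<longleftrightarrow> u = x \<and> v = y"
  by (auto simp: inner4_def doubleton_eq_iff)

lemma outer4_neq_inner4: "outer4 u v \<noteq> inner4 x y"
  by (simp add: outer4_def inner4_def doubleton_eq_iff)

lemma inner4_meets_outer4: "inner4 u v \<inter> outer4 x y \<noteq> {} \<Longrightarrow> x = u \<and> y = v"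
  by (simp add: inner4_def outer4_def doubleton_eq_iff split: if_splits)

lemma inner4_meets_inner4:
  "inner4 u v \<inter> inner4 x y \<noteq> {} \<Longrightarrow> (x, y) = (u, v) \<or> (x, y) = (v, u)"
  by (simp add: inner4_def doubleton_eq_iff split: if_splits)

text \<open>Both ends of an inner segment are internal vertices, which have degree 2; hence the segment has
  at most two adjacent edges, however large the degrees in \<open>G\<close> are.\<close>

lemma adjacent_inner4:
  assumes "f \<in> edges (subdivision 4 G)" and "adjacent_edges (inner4 u v) f"
  shows "f \<in> {outer4 u v, inner4 v u}"
proof -
  have f: "f \<noteq> inner4 u v" "inner4 u v \<inter> f \<noteq> {}"
    using assms(2) by (auto simp: adjacent_edges_def)
  obtain x y where "f = outer4 x y \<or> f = inner4 x y"
    using assms(1) unfolding edges_subdivision_4 by blast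
  then show ?thesis
  proof
    assume "f = outer4 x y"
    then show ?thesis
      using inner4_meets_outer4[of u v x y] f(2) by simp
  next
    assume "f = inner4 x y"
    then show ?thesis
      using inner4_meets_inner4[of u v x y] f by auto
  qed
qed

text \<open>Every segment has exactly one inner segment among its neighbors: the one on its own side if it
  is outer, the opposite one if it is inner.  Neighborhoods of different inner segments are thus
  disjoint.\<close>

lemma disjoint_inner4_neighborhoods:
  assumes "f \<in> {outer4 u v, inner4 v u}" and "f \<in> {outer4 x y, inner4 y x}"
  shows "(u, v) = (x, y)"
  using assms by (elim insertE emptyE)
    (simp_all add: outer4_eq_iff inner4_eq_iff outer4_neq_inner4 outer4_neq_inner4[symmetric])

text \<open>Choosing for each dart a class that its inner segment dominates is injective, since color
  classes are nonempty and the neighborhoods of different inner segments are disjoint.\<close>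

lemma card_color_classes_subdivision_4_ge:
  assumes "simple_graph G"
    and tde: "TDE_coloring (subdivision 4 G) c"
    and fin: "finite (color_classes (subdivision 4 G) c)"
  shows "finite (edges G)" and "2 * card (edges G) \<le> card (color_classes (subdivision 4 G) c)"
proof -
  let ?H = "subdivision 4 G"
  have "\<forall>d\<in>darts G. \<exists>C. C \<in> color_classes ?H c \<and>
      (\<forall>f\<in>C. adjacent_edges (inner4 (fst d) (snd d)) f)"
  proof
    fix d assume "d \<in> darts G"
    then have "{fst d, snd d} \<in> edges G"
      by (auto simp: darts_def)
    then have "inner4 (fst d) (snd d) \<in> edges ?H"
      unfolding edges_subdivision_4 by blast
    then show "\<exists>C. C \<in> color_classes ?H c \<and>
        (\<forall>f\<in>C. adjacent_edges (inner4 (fst d) (snd d)) f)"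
      using tde unfolding TDE_coloring_def by blast
  qed
  from bchoice[OF this] obtain K where K_spec: "\<forall>d\<in>darts G. K d \<in> color_classes ?H c \<and>
      (\<forall>f\<in>K d. adjacent_edges (inner4 (fst d) (snd d)) f)"
    by (rule exE)
  have K: "K (u, v) \<in> color_classes ?H c" "\<forall>f\<in>K (u, v). adjacent_edges (inner4 u v) f"
    if "(u, v) \<in> darts G" for u v
    using bspec[OF K_spec that] by simp_all
  have K_sub: "K (u, v) \<subseteq> {outer4 u v, inner4 v u}" and K_ne: "K (u, v) \<noteq> {}"
    if "(u, v) \<in> darts G" for u v
  proof -
    have "K (u, v) \<subseteq> edges ?H" and "K (u, v) \<noteq> {}"
      using K(1)[OF that] by (auto simp: color_classes_altdef)
    then show "K (u, v) \<subseteq> {outer4 u v, inner4 v u}" "K (u, v) \<noteq> {}"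
      using K(2)[OF that] adjacent_inner4[of _ G u v] by auto
  qed
  have inj: "inj_on K (darts G)"
  proof (rule inj_onI, clarify)
    fix u v x y
    assume d: "(u, v) \<in> darts G" "(x, y) \<in> darts G" and eq: "K (u, v) = K (x, y)"
    obtain f where f: "f \<in> K (u, v)"
      using K_ne[OF d(1)] by (meson ex_in_conv)
    moreover have "f \<in> K (x, y)"
      using f eq by simp
    ultimately show "u = x \<and> v = y"
      using disjoint_inner4_neighborhoods[OF subsetD[OF K_sub[OF d(1)]] subsetD[OF K_sub[OF d(2)]]]
      by simp
  qed
  have K_classes: "K ` darts G \<subseteq> color_classes ?H c"
    using K(1) by auto
  have "finite (darts G)"
    using inj_on_finite[OF inj K_classes fin] .
  then show fin_edges: "finite (edges G)"
    unfolding edges_eq_darts[OF assms(1)] by (rule finite_imageI)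
  show "2 * card (edges G) \<le> card (color_classes ?H c)"
    using card_inj_on_le[OF inj K_classes fin] by (simp add: card_darts[OF assms(1) fin_edges])
qed

section \<open>Comparison\<close>

theorem theorem4p9:
  fixes G :: "'a ugraph"
  assumes "simple_graph G"
  shows "TDE_chromatic_number (subdivision 3 G) \<le> TDE_chromatic_number (subdivision 4 G)"
  unfolding TDE_chromatic_number_def[of "subdivision 4 G"]
proof (rule INF_greatest, clarify)
  fix c :: "'a subdiv_vertex set \<Rightarrow> nat"
  assume c: "TDE_coloring (subdivision 4 G) c" "finite (color_classes (subdivision 4 G) c)"
  note bounds = card_color_classes_subdivision_4_ge[OF assms c]
  have "TDE_chromatic_number (subdivision 3 G) \<le> enat (2 * card (edges G))"
    using TDE_chromatic_number_subdivision_3_le[OF assms bounds(1)] .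
  also have "\<dots> \<le> enat (card (color_classes (subdivision 4 G) c))"
    using bounds(2) by simp
  finally show "TDE_chromatic_number (subdivision 3 G)
      \<le> enat (card (color_classes (subdivision 4 G) c))" .
qed

end
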